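(* Let $A-\lambda B$, $A,B\in\mathbb{C}^{n\times n}$, be a diagonalizable pencil with only finite eigenvalues, and let $X,Y\in\mathbb{C}^{n\times n}$ and $\tilde\lambda_1,\dots,\tilde\lambda_n\in\mathbb{C}$ be such that \[Y^HAX=\mathrm{diag}(\tilde\lambda_1,\dots,\tilde\lambda_n)+E,\qquad Y^HBX=I+F,\] where $E=(e_{j,l})$ and $F=(f_{j,l})$ have zero diagonal. Put $E_j=\sum_l|e_{j,l}|$, $F_j=\sum_l|f_{j,l}|$, assume $F_j<1$ for all $j$, and put $\rho_j=\frac{|\tilde\lambda_j|F_j+E_j}{1-F_j}$ and $D_j=\{z\in\mathbb{C}:|z-\tilde\lambda_j|\le\rho_j\}$ for $1\le j\le n$. Fix $i$ and suppose that $\tilde\lambda_i$ is simple, i.e. $\delta:=\min_{j\ne i}|\tilde\lambda_i-\tilde\lambda_j|>0$, and that the disk $D_i$ is disjoint from all the other disks $D_j$, $j\neq i$. Let \[\delta'=\delta-\rho_i,\qquad r=\frac{1}{1-F_i}\max_{1\le j\le n}\{(2|\tilde\lambda_j|+|\tilde\lambda_i|)F_j+E_j\}.\] Then the eigenvalue $\lambda_i$ of the pencil $A-\lambda B$ lying in $D_i$ (there is exactly one) satisfies \[|\lambda_i-\tilde\lambda_i|\le\frac{r^2}{\delta'}.\]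
   Context: The finite eigenvalues of the pencil $A-\lambda B$ are the roots of $\det(A-\lambda B)$, counted with multiplicity; having only finite eigenvalues means that there are $n$ of them. $Y^H$ is the conjugate transpose of $Y$. The numbers $\tilde\lambda_j$ play the role of computed eigenvalues, and $X$, $Y$ of normalized computed right and left eigenvectors; "simple" refers to the list $\tilde\lambda_1,\dots,\tilde\lambda_n$. Here $n\ge2$. *)

theory Defs
  imports "HOL-Analysis.Analysis" "HOL-Computational_Algebra.Polynomial"
begin

definition conj_transpose :: "complex^'n^'m \<Rightarrow> complex^'m^'n" where
  "conj_transpose Y = (\<chi> i j. cnj (Y $ j $ i))"

definition diag :: "complex^'n \<Rightarrow> complex^'n^'n" where
  "diag v = (\<chi> i j. if i = j then v $ i else 0)"

(* det (A - lambda B) as a polynomial in lambda: the determinant is taken over the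
   polynomial ring; pencil_poly_eval below confirms its values. *)
definition pencil_poly :: "complex^'n^'n \<Rightarrow> complex^'n^'n \<Rightarrow> complex poly" where
  "pencil_poly A B = det (\<chi> i j. [: A $ i $ j, - (B $ i $ j) :])"

lemma pencil_poly_eval: "poly (pencil_poly A B) z = det (A - mat z ** B)"
proof -
  have "(mat z ** B) $ i $ j = z * B $ i $ j" for i j
    by (simp add: matrix_matrix_mult_def mat_def if_distrib if_distribR sum.delta cong: if_cong)
  then show ?thesis
    by (simp add: pencil_poly_def det_def poly_sum poly_prod of_int_poly)
qed

(* For a singular pencil (pencil_poly A B = 0) this multiset is empty, since proots 0 = {#}. *)
definition finite_eigenvalues :: "complex^'n^'n \<Rightarrow> complex^'n^'n \<Rightarrow> complex multiset" where
  "finite_eigenvalues A B = proots (pencil_poly A B)"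

definition only_finite_eigenvalues :: "complex^'n^'n \<Rightarrow> complex^'n^'n \<Rightarrow> bool" where
  "only_finite_eigenvalues A B \<longleftrightarrow>
     pencil_poly A B \<noteq> 0 \<and> size (finite_eigenvalues A B) = CARD('n)"

(* Strict equivalence to a diagonal pencil. *)
definition diagonalizable_pencil :: "complex^'n^'n \<Rightarrow> complex^'n^'n \<Rightarrow> bool" where
  "diagonalizable_pencil A B \<longleftrightarrow>
     (\<exists>(P :: complex^'n^'n) (Q :: complex^'n^'n) a b.
        invertible P \<and> invertible Q \<and> P ** A ** Q = diag a \<and> P ** B ** Q = diag b)"

end

theory Submission
  imports Defs "HOL-Complex_Analysis.Residue_Theorem"
begin

text \<open>Since \<open>I + F\<close> is strictly diagonally dominant, \<open>X\<close> and \<open>Y\<close> are invertible, so one may work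
  with \<open>C z = diag lam + E - z (I + F)\<close>. Row \<open>j\<close> of \<open>C z\<close> is strictly dominant for \<open>z \<notin> D j\<close>.
  Scaling the off-diagonal part of row \<open>i\<close> by any \<open>s\<close> with \<open>\<bar>s\<bar> \<le> 1\<close> keeps the matrix nonsingular on
  a circle slightly larger than the boundary of \<open>D i\<close>. As the determinant is affine in \<open>s\<close>, Rouche's
  theorem applies directly to \<open>s = 0\<close> and \<open>s = 1\<close>, without a continuity argument for eigenvalues;
  for \<open>s = 0\<close> the only zero in the disk is \<open>lam $ i\<close>.

  A kernel vector of \<open>C \<mu>\<close> has its largest entry at \<open>i\<close> because \<open>\<mu>\<close> lies in no other disk. If its
  second largest entry is at \<open>j\<close>, row \<open>j\<close> bounds the ratio of the two by \<open>r / \<delta>'\<close>, and row \<open>i\<close>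
  bounds \<open>\<bar>\<mu> - lam $ i\<bar>\<close> by \<open>\<rho> i \<le> r\<close> times this ratio.\<close>

section \<open>Kernel vectors and diagonal dominance\<close>

lemma det_zero_imp_kernel:
  fixes A :: "'a::field^'n^'n"
  assumes "det A = 0"
  obtains v where "v \<noteq> 0" "A *v v = 0"
proof -
  have "\<not> (\<forall>v. A *v v = 0 \<longrightarrow> v = 0)"
    using assms unfolding matrix_left_invertible_ker[symmetric]
    by (simp flip: invertible_left_inverse add: invertible_det_nz)
  then show ?thesis using that by blast
qed

lemma kernel_row:
  fixes C :: "'a::field^'n^'n"
  assumes "C *v v = 0"
  shows "C $ j $ j * v $ j = - (\<Sum>l\<in>UNIV - {j}. C $ j $ l * v $ l)"
proof -
  have "(\<Sum>l\<in>UNIV. C $ j $ l * v $ l) = 0"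
    using assms by (simp add: vec_eq_iff matrix_vector_mult_def)
  then show ?thesis
    by (simp add: sum.remove[of UNIV j] eq_neg_iff_add_eq_0)
qed

text \<open>The bound \<open>t\<close> concerns only the entries off \<open>j\<close>, so it may be
  the second largest modulus when \<open>v $ j\<close> is the largest entry.\<close>

lemma kernel_row_norm:
  fixes C :: "'a::real_normed_field^'n^'n"
  assumes "C *v v = 0" "\<And>l. l \<noteq> j \<Longrightarrow> norm (v $ l) \<le> t"
  shows "norm (C $ j $ j) * norm (v $ j) \<le> (\<Sum>l\<in>UNIV - {j}. norm (C $ j $ l)) * t"
proof -
  have "norm (C $ j $ j) * norm (v $ j) = norm (\<Sum>l\<in>UNIV - {j}. C $ j $ l * v $ l)"
    unfolding norm_mult[symmetric] kernel_row[OF assms(1), of j] by (rule norm_minus_cancel)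
  also have "\<dots> \<le> (\<Sum>l\<in>UNIV - {j}. norm (C $ j $ l) * t)"
    by (rule sum_norm_le) (auto simp: norm_mult intro!: mult_left_mono assms(2))
  finally show ?thesis by (simp add: sum_distrib_right)
qed

text \<open>Gershgorin's argument: the row belonging to an entry of largest modulus cannot be
  strictly dominant.\<close>

lemma kernel_max_row:
  fixes C :: "'a::real_normed_field^'n^'n"
  assumes "C *v v = 0" "v \<noteq> 0"
  obtains j where "v $ j \<noteq> 0" "\<And>l. norm (v $ l) \<le> norm (v $ j)"
    "norm (C $ j $ j) \<le> (\<Sum>l\<in>UNIV - {j}. norm (C $ j $ l))"
proof -
  define m where "m = Max (range (\<lambda>l. norm (v $ l)))"
  have "m \<in> range (\<lambda>l. norm (v $ l))" unfolding m_def by (rule Max_in) auto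
  then obtain j where j: "m = norm (v $ j)" by auto
  have le: "norm (v $ l) \<le> norm (v $ j)" for l
    unfolding j[symmetric] m_def by (rule Max_ge) auto
  have nz: "v $ j \<noteq> 0"
  proof
    assume "v $ j = 0"
    then have "v $ l = 0" for l using le[of l] by simp
    with assms(2) show False by (simp add: vec_eq_iff)
  qed
  have "norm (C $ j $ j) \<le> (\<Sum>l\<in>UNIV - {j}. norm (C $ j $ l))"
    using kernel_row_norm[OF assms(1), of j "norm (v $ j)"] le nz
    by (simp add: mult_le_cancel_right)
  with nz le show ?thesis using that by blast
qed

lemma diag_dominant_det_nonzero:
  fixes C :: "'a::real_normed_field^'n^'n"
  assumes "\<And>j. (\<Sum>l\<in>UNIV - {j}. norm (C $ j $ l)) < norm (C $ j $ j)"
  shows "det C \<noteq> 0"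
proof
  assume "det C = 0"
  then obtain v where "v \<noteq> 0" "C *v v = 0" by (rule det_zero_imp_kernel)
  then obtain j where "norm (C $ j $ j) \<le> (\<Sum>l\<in>UNIV - {j}. norm (C $ j $ l))"
    using kernel_max_row by blast
  with assms[of j] show False by simp
qed

text \<open>Links the analytic order of a zero, used in Rouche's theorem, to the algebraic
  multiplicity counted by \<open>proots\<close>.\<close>

lemma zorder_poly:
  fixes p :: "complex poly"
  assumes "p \<noteq> 0"
  shows "zorder (poly p) z = int (order z p)"
proof -
  obtain q where q: "p = [:- z, 1:] ^ order z p * q" "\<not> [:- z, 1:] dvd q"
    using order_decomp[OF assms] by blast
  have "poly p w = poly q w * (w - z) powi int (order z p)" for w
    by (subst q(1)) (simp add: poly_power)
  then show ?thesis
    using q(2) by (intro zorder_eqI[of UNIV z "poly q"])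
      (auto simp: poly_eq_0_iff_dvd intro: holomorphic_intros)
qed

lemma size_filter_proots:
  fixes p :: "complex poly"
  assumes "p \<noteq> 0"
  shows "size (filter_mset P (proots p)) = (\<Sum>z | poly p z = 0 \<and> P z. order z p)"
  unfolding size_multiset_overloaded_eq
  by (rule sum.cong) (auto simp: assms)

text \<open>The winding number of the circle is 1 at zeros inside and 0 at zeros outside, so the
  weighted sums in Rouche's theorem become multiset sizes.\<close>

lemma rouche_proots:
  fixes p q :: "complex poly"
  assumes "R > 0" and less: "\<And>z. z \<in> sphere c R \<Longrightarrow> norm (poly p z - poly q z) < norm (poly q z)"
  shows "size (filter_mset (\<lambda>z. z \<in> ball c R) (proots p)) =
         size (filter_mset (\<lambda>z. z \<in> ball c R) (proots q))"
proof -
  have ne: "poly p z \<noteq> 0" "poly q z \<noteq> 0" if "z \<in> sphere c R" for z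
    using less[OF that] by auto
  have "c + of_real R \<in> sphere c R" using assms(1) by (simp add: dist_norm)
  then have nz: "p \<noteq> 0" "q \<noteq> 0" using ne by fastforce+
  have count: "(\<Sum>z | poly u z = 0. winding_number (circlepath c R) z * zorder (poly u) z)
      = of_nat (size (filter_mset (\<lambda>z. z \<in> ball c R) (proots u)))"
    if "u \<noteq> 0" "\<And>z. z \<in> sphere c R \<Longrightarrow> poly u z \<noteq> 0" for u
  proof -
    have "(\<Sum>z | poly u z = 0. winding_number (circlepath c R) z * zorder (poly u) z)
        = (\<Sum>z | poly u z = 0 \<and> z \<in> ball c R. of_nat (order z u))"
    proof (rule sum.mono_neutral_cong_right)
      show "finite {z. poly u z = 0}" using that poly_roots_finite by blast
      show "\<forall>z\<in>{z. poly u z = 0} - {z. poly u z = 0 \<and> z \<in> ball c R}.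
          winding_number (circlepath c R) z * zorder (poly u) z = 0"
      proof
        fix z assume "z \<in> {z. poly u z = 0} - {z. poly u z = 0 \<and> z \<in> ball c R}"
        then have "z \<notin> cball c R" using that(2)[of z] by (auto simp: dist_norm)
        then have "winding_number (circlepath c R) z = 0"
          using assms(1) by (intro winding_number_zero_outside[of _ "cball c R"]) auto
        then show "winding_number (circlepath c R) z * zorder (poly u) z = 0" by simp
      qed
    qed (use that zorder_poly in \<open>auto simp: dist_norm norm_minus_commute winding_number_circlepath\<close>)
    then show ?thesis using size_filter_proots[OF that(1)] by simp
  qed
  have "(\<Sum>z\<in>{z\<in>UNIV. poly q z + poly (p - q) z = 0}.
          winding_number (circlepath c R) z * zorder (\<lambda>z. poly q z + poly (p - q) z) z)
      = (\<Sum>z\<in>{z\<in>UNIV. poly q z = 0}. winding_number (circlepath c R) z * zorder (poly q) z)"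
    by (rule Rouche_theorem)
       (use assms nz poly_roots_finite in \<open>auto intro!: holomorphic_intros simp: poly_roots_finite\<close>)
  then show ?thesis using count[of p] count[of q] nz ne by simp
qed

text \<open>Otherwise \<open>s = - a / b\<close> would lie in the unit disk. This turns
  nonsingularity of an affine family into the strict inequality for Rouche's theorem.\<close>

lemma norm_less_of_disc_nonzero:
  fixes a b :: "'a::real_normed_field"
  assumes "\<And>s. norm s \<le> 1 \<Longrightarrow> a + s * b \<noteq> 0"
  shows "norm b < norm a"
proof (rule ccontr)
  assume "\<not> norm b < norm a"
  moreover have "a \<noteq> 0" using assms[of 0] by simp
  ultimately have "b \<noteq> 0" "norm (- a / b) \<le> 1" by (auto simp: norm_divide divide_simps)
  with assms[of "- a / b"] show False by simp
qed

lemma mat_mult_left_component: "(mat z ** N) $ j $ l = z * (N $ j $ l :: 'a::semiring_1)"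
  by (simp add: matrix_matrix_mult_def mat_def mult_delta_left)

lemma mat_mult_right_component: "(N ** mat z) $ j $ l = (N $ j $ l :: 'a::semiring_1) * z"
  by (simp add: matrix_matrix_mult_def mat_def mult_delta_right)

lemma pencil_root_count_isolated_row:
  fixes M N :: "complex^'n^'n"
  assumes "R > 0" "N $ i $ i = 1"
    and other: "\<And>z j. z \<in> cball (M $ i $ i) R \<Longrightarrow> j \<noteq> i \<Longrightarrow>
      (\<Sum>l\<in>UNIV - {j}. norm (M $ j $ l - z * N $ j $ l)) < norm (M $ j $ j - z * N $ j $ j)"
    and row_i: "\<And>z. z \<in> sphere (M $ i $ i) R \<Longrightarrow>
      (\<Sum>l\<in>UNIV - {i}. norm (M $ i $ l - z * N $ i $ l)) < norm (M $ i $ i - z * N $ i $ i)"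
  shows "size (filter_mset (\<lambda>z. z \<in> ball (M $ i $ i) R) (finite_eigenvalues M N)) = 1"
proof -
  let ?c = "M $ i $ i"
  define C where "C z = M - mat z ** N" for z
  have C: "C z $ j $ l = M $ j $ l - z * N $ j $ l" for z j l
    by (simp add: C_def mat_mult_left_component)
  define p where "p = pencil_poly M N"
  \<comment> \<open>\<open>k\<close> is the principal minor obtained by deleting row and column
    \<open>i\<close>; hence \<open>q\<close> is the determinant with row \<open>i\<close> reduced to
    its diagonal entry.\<close>
  define k where "k = pencil_poly (\<chi> a. if a = i then axis i 1 else M $ a)
    (\<chi> a. if a = i then 0 else N $ a)"
  define q where "q = [:?c, -1:] * k"
  define g where "g z = (\<chi> l. if l = i then 0 else C z $ i $ l)" for z
  have p: "poly p z = det (C z)" for z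
    by (simp add: p_def pencil_poly_eval C_def)
  have k: "poly k z = det (\<chi> a. if a = i then axis i 1 else C z $ a)" for z
    unfolding k_def pencil_poly_eval
    by (rule arg_cong[of _ _ det]) (auto simp: vec_eq_iff mat_mult_left_component C)
  have q: "poly q z = det (\<chi> a. if a = i then (?c - z) *s axis i 1 else C z $ a)" for z
    by (simp add: q_def k det_row_mul algebra_simps)
  have split: "det (\<chi> a. if a = i then (?c - z) *s axis i 1 + s *s g z else C z $ a)
      = poly q z + s * det (\<chi> a. if a = i then g z else C z $ a)" for z s
    by (simp add: det_row_add q det_row_mul)
  have Crow: "(\<chi> a. if a = i then (?c - z) *s axis i 1 + 1 *s g z else C z $ a) = C z" for z
    using assms(2) by (auto simp: vec_eq_iff C g_def axis_def)
  have diff: "poly p z - poly q z = det (\<chi> a. if a = i then g z else C z $ a)" for z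
    using split[of z 1] unfolding Crow p by simp
  have "norm (poly p z - poly q z) < norm (poly q z)" if z: "z \<in> sphere ?c R" for z
  proof (rule norm_less_of_disc_nonzero)
    fix s :: complex assume s: "norm s \<le> 1"
    let ?G = "\<chi> a. if a = i then (?c - z) *s axis i 1 + s *s g z else C z $ a"
    have "det ?G \<noteq> 0"
    proof (rule diag_dominant_det_nonzero)
      fix j
      show "(\<Sum>l\<in>UNIV - {j}. norm (?G $ j $ l)) < norm (?G $ j $ j)"
      proof (cases "j = i")
        case True
        have "(\<Sum>l\<in>UNIV - {i}. norm (?G $ i $ l)) \<le> (\<Sum>l\<in>UNIV - {i}. norm (C z $ i $ l))"
          using s by (intro sum_mono) (auto simp: g_def axis_def norm_mult mult_left_le_one_le)
        then show ?thesis using row_i[OF z] True assms(2) by (simp add: C g_def axis_def)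
      next
        case False
        then show ?thesis using other[of z j] z by (simp add: C)
      qed
    qed
    then show "poly q z + s * (poly p z - poly q z) \<noteq> 0" unfolding split diff .
  qed
  from rouche_proots[OF assms(1) this]
  have "size (filter_mset (\<lambda>z. z \<in> ball ?c R) (proots p)) =
      size (filter_mset (\<lambda>z. z \<in> ball ?c R) (proots q))" .
  \<comment> \<open>The rows other than \<open>i\<close> are dominant on the whole closed disk, not
    only on the circle, so the linear factor supplies the only zero of \<open>q\<close>
    inside.\<close>
  moreover have kz: "poly k z \<noteq> 0" if "z \<in> cball ?c R" for z
    unfolding k
  proof (rule diag_dominant_det_nonzero)
    fix j
    show "(\<Sum>l\<in>UNIV - {j}. norm ((\<chi> a. if a = i then axis i 1 else C z $ a) $ j $ l))
        < norm ((\<chi> a. if a = i then axis i 1 else C z $ a) $ j $ j)"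
      using other[OF that, of j] by (cases "j = i") (auto simp: C axis_def)
  qed
  then have "k \<noteq> 0" using assms(1) by (metis centre_in_cball less_imp_le poly_0)
  moreover have "proots [:?c, -1:] = {#?c#}"
    using proots_uminus[of "[:?c, -1:]"] by simp
  moreover have "filter_mset (\<lambda>z. z \<in> ball ?c R) (proots k) = {#}"
    using kz \<open>k \<noteq> 0\<close> by (auto simp: multiset_eq_iff order_0I)
  moreover have "proots q = proots [:?c, -1:] + proots k"
    unfolding q_def using \<open>k \<noteq> 0\<close> by (intro proots_mult) auto
  ultimately show ?thesis
    using assms(1) by (simp add: finite_eigenvalues_def p_def)
qed

lemma cball_disjoint_iff:
  fixes a b :: "'a::real_normed_vector"
  assumes "0 \<le> r" "0 \<le> s"
  shows "cball a r \<inter> cball b s = {} \<longleftrightarrow> r + s < dist a b"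
proof
  assume disj: "cball a r \<inter> cball b s = {}"
  show "r + s < dist a b"
  proof (rule ccontr)
    assume "\<not> r + s < dist a b"
    let ?d = "norm (b - a)" and ?m = "min r (norm (b - a))"
    \<comment> \<open>A point of the segment from \<open>a\<close> to \<open>b\<close>; the minimum
      keeps it from passing \<open>b\<close>. If \<open>?d = 0\<close>, the quotient is 0 and
      \<open>?z = a\<close>.\<close>
    let ?z = "a + (?m / ?d) *\<^sub>R (b - a)"
    have "norm (?z - a) = ?m" using assms by auto
    moreover have "norm (?z - b) = ?d - ?m"
    proof (cases "?d = 0")
      case False
      have "?z - b = - ((1 - ?m / ?d) *\<^sub>R (b - a))" by (simp add: algebra_simps)
      then have "norm (?z - b) = \<bar>1 - ?m / ?d\<bar> * ?d" by (simp del: minus_diff_eq)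
      also have "\<dots> = ?d - ?m" using False by (subst abs_of_nonneg) (auto simp: field_simps)
      finally show ?thesis .
    qed (use assms in auto)
    ultimately have "?z \<in> cball a r \<inter> cball b s"
      using \<open>\<not> r + s < dist a b\<close> assms by (auto simp: dist_norm norm_minus_commute)
    with disj show False by blast
  qed
qed (rule disjoint_cballI)

text \<open>The characteristic polynomial is only multiplied by the nonzero constant
  \<open>det P * det Q\<close>.\<close>

lemma finite_eigenvalues_equivalent:
  fixes A B P Q :: "complex^'n^'n"
  assumes "invertible P" "invertible Q"
  shows "finite_eigenvalues (P ** A ** Q) (P ** B ** Q) = finite_eigenvalues A B"
proof -
  have diff: "P ** (M - N) ** Q = P ** M ** Q - P ** N ** Q" for M N :: "complex^'n^'n"
    by (simp add: vec_eq_iff matrix_matrix_mult_def sum_subtractf left_diff_distrib right_diff_distrib)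
  have "P ** A ** Q - mat z ** (P ** B ** Q) = P ** (A - mat z ** B) ** Q" for z
  proof -
    have "mat z ** P = P ** mat z"
      by (simp add: vec_eq_iff mat_mult_left_component mat_mult_right_component)
    then have "mat z ** (P ** B ** Q) = P ** (mat z ** B) ** Q"
      by (metis matrix_mul_assoc)
    then show ?thesis
      by (simp add: diff)
  qed
  then have "poly (pencil_poly (P ** A ** Q) (P ** B ** Q)) =
      poly (smult (det P * det Q) (pencil_poly A B))"
    by (auto simp: pencil_poly_eval det_mul)
  then have "pencil_poly (P ** A ** Q) (P ** B ** Q) = smult (det P * det Q) (pencil_poly A B)"
    by (simp add: poly_eq_poly_eq_iff)
  then show ?thesis
    using assms by (simp add: finite_eigenvalues_def invertible_det_nz)
qed

text \<open>Here \<open>d\<close>, \<open>w\<close> are the distances of the eigenvalue from \<open>lam $ i\<close> and \<open>lam $ j\<close>,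
  \<open>u\<close> is its modulus, \<open>x\<close> the distance of \<open>lam $ i\<close> and \<open>lam $ j\<close>, and \<open>a\<close> is
  \<open>\<bar>v $ j\<bar> / \<bar>v $ i\<bar>\<close> for an eigenvector \<open>v\<close> with second largest entry at \<open>j\<close>. The crude bound
  \<open>u \<le> li + d\<close> does not give \<open>w * a \<le> r\<close>: if \<open>w \<le> x\<close> one has to use
  \<open>u \<le> lj + w \<le> 2 * lj + li\<close>, and if \<open>x < w\<close> the excess \<open>d * Fj \<le> \<rho> * a\<close> is absorbed by
  the loss from \<open>\<delta>\<close> to \<open>\<delta> - \<rho>\<close>.\<close>
lemma eigenvalue_error_bound_arith:
  fixes d a u w x li lj Ei Ej Fi Fj r \<rho> \<delta> :: real
  assumes pos: "0 \<le> d" "0 \<le> a" "a \<le> 1" "0 \<le> Fi" "Fi < 1" "0 \<le> Fj" "Fj < 1" "0 \<le> li" "0 \<le> lj"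
    and row_i: "d \<le> (Ei + u * Fi) * a" and row_j: "w * a \<le> Ej + u * Fj"
    and u: "u \<le> li + d" "u \<le> lj + w"
    and x: "x \<le> w + d" "x \<le> li + lj" "\<delta> \<le> x"
    and \<rho>: "\<rho> = (li * Fi + Ei) / (1 - Fi)" "d \<le> \<rho>" "\<rho> < \<delta>"
    and r: "(2 * li + li) * Fi + Ei \<le> (1 - Fi) * r" "(2 * lj + li) * Fj + Ej \<le> (1 - Fi) * r"
  shows "d \<le> r\<^sup>2 / (\<delta> - \<rho>)"
proof -
  have \<rho>': "\<rho> * (1 - Fi) = li * Fi + Ei" using pos \<rho> by simp
  have "li * Fi \<ge> 0" using pos by simp
  then have "\<rho> * (1 - Fi) \<le> r * (1 - Fi)" using r(1) \<rho>' by (simp add: algebra_simps)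
  then have \<rho>r: "\<rho> \<le> r" using pos by simp
  have r0: "0 \<le> r" using \<rho>r \<rho>(2) pos by simp
  have r_le: "(1 - Fi) * r \<le> r" using pos r0 by (simp add: mult_left_le_one_le)
  have d: "d \<le> \<rho> * a"
  proof -
    have "u * Fi \<le> (li + d) * Fi" using u pos by (intro mult_right_mono) auto
    then have "(Ei + u * Fi) * a \<le> (Ei + (li + d) * Fi) * a"
      using pos by (intro mult_right_mono) auto
    \<comment> \<open>Dropping \<open>a\<close> here lets \<open>d * Fi\<close> move to the left,
      producing the factor \<open>1 - Fi\<close> from the denominator of \<rho>.\<close>
    moreover have "d * Fi * a \<le> d * Fi" using pos by (simp add: mult_left_le)
    ultimately have "d * (1 - Fi) \<le> (Ei + li * Fi) * a" using row_i by (simp add: algebra_simps)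
    also have "\<dots> = (\<rho> * a) * (1 - Fi)" using \<rho>' by (metis add.commute mult.commute mult.assoc)
    finally show ?thesis using pos by simp
  qed
  have "a * (\<delta> - \<rho>) \<le> r"
  proof (cases "w \<le> x")
    case True
    then have "u * Fj \<le> (2 * lj + li) * Fj" using u x pos by (intro mult_right_mono) auto
    then have "w * a \<le> r" using row_j r r_le by simp
    moreover have "a * (\<delta> - \<rho>) \<le> a * w" using x \<rho> pos by (intro mult_left_mono) auto
    ultimately show ?thesis by (simp add: mult.commute)
  next
    case False
    have "a * \<delta> \<le> w * a" using False x pos mult_right_mono[of \<delta> w a] by (simp add: mult.commute)
    also have "\<dots> \<le> Ej + (li + d) * Fj"
      using row_j u pos by (meson add_left_mono mult_right_mono order_trans)
    finally have 1: "a * \<delta> \<le> Ej + li * Fj + d * Fj" by (simp add: algebra_simps)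
    have "d * Fj \<le> d" using pos by (simp add: mult_left_le)
    with d have "d * Fj \<le> \<rho> * a" by simp
    moreover have "0 \<le> lj * Fj"
      using pos by simp
    ultimately show ?thesis using 1 r(2) r_le by (simp add: algebra_simps)
  qed
  then have "\<rho> * (a * (\<delta> - \<rho>)) \<le> r * r" using \<rho>r r0 \<rho>(2,3) pos by (intro mult_mono mult_nonneg_nonneg) auto
  moreover have "d * (\<delta> - \<rho>) \<le> (\<rho> * a) * (\<delta> - \<rho>)" using d \<rho>(3) by (intro mult_right_mono) auto
  ultimately have "d * (\<delta> - \<rho>) \<le> r\<^sup>2" by (simp add: power2_eq_square mult.assoc)
  then show ?thesis using \<rho>(3) by (simp add: pos_le_divide_eq)
qed

theorem mainTheorem8:
  fixes A B X Y E F :: "complex^'n^'n"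
    and lam :: "complex^'n"
    and Es Fs \<rho> :: "'n \<Rightarrow> real"
    and D :: "'n \<Rightarrow> complex set"
    and i :: 'n
    and \<delta> \<delta>' r :: real
  assumes "CARD('n) \<ge> 2"
    and "diagonalizable_pencil A B"
    and "only_finite_eigenvalues A B"
    and "conj_transpose Y ** A ** X = diag lam + E"
    and "conj_transpose Y ** B ** X = mat 1 + F"
    and "\<And>j. E $ j $ j = 0"
    and "\<And>j. F $ j $ j = 0"
    and "\<And>j. Es j = (\<Sum>l\<in>UNIV. cmod (E $ j $ l))"
    and "\<And>j. Fs j = (\<Sum>l\<in>UNIV. cmod (F $ j $ l))"
    and "\<And>j. Fs j < 1"
    and "\<And>j. \<rho> j = (cmod (lam $ j) * Fs j + Es j) / (1 - Fs j)"
    and "\<And>j. D j = {z. cmod (z - lam $ j) \<le> \<rho> j}"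
    and "\<delta> = Min ((\<lambda>j. cmod (lam $ i - lam $ j)) ` (UNIV - {i}))"
    and "\<delta> > 0"
    and "\<And>j. j \<noteq> i \<Longrightarrow> D i \<inter> D j = {}"
    and "\<delta>' = \<delta> - \<rho> i"
    and "r = 1 / (1 - Fs i) *
           Max (range (\<lambda>j. (2 * cmod (lam $ j) + cmod (lam $ i)) * Fs j + Es j))"
  shows "\<exists>\<mu>. filter_mset (\<lambda>z. z \<in> D i) (finite_eigenvalues A B) = {#\<mu>#} \<and>
           cmod (\<mu> - lam $ i) \<le> r\<^sup>2 / \<delta>'"
proof -
  define M where "M = conj_transpose Y ** A ** X"
  define N where "N = conj_transpose Y ** B ** X"
  note E0 = assms(6) and F0 = assms(7) and Es = assms(8) and Fs = assms(9) and F1 = assms(10)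
    and \<rho> = assms(11) and D = assms(12) and \<delta> = assms(13) and disj = assms(15)
    and \<delta>' = assms(16) and r = assms(17)
  have MN: "M = diag lam + E" "N = mat 1 + F" using assms(4,5) by (simp_all add: M_def N_def)
  have on: "M $ j $ j = lam $ j" "N $ j $ j = 1" for j
    using E0 F0 by (simp_all add: MN diag_def mat_def)
  have off: "M $ j $ l = E $ j $ l" "N $ j $ l = F $ j $ l" if "l \<noteq> j" for j l
    using that by (simp_all add: MN diag_def mat_def)
  have nonneg: "0 \<le> Es j" "0 \<le> Fs j" for j by (simp_all add: Es Fs sum_nonneg)
  have \<rho>_nonneg: "0 \<le> \<rho> j" for j using nonneg F1[of j] by (simp add: \<rho>)
  have \<rho>_eq: "\<rho> j * (1 - Fs j) = cmod (lam $ j) * Fs j + Es j" for j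
    using F1[of j] by (simp add: \<rho>)
  have offsum: "(\<Sum>l\<in>UNIV - {j}. cmod (M $ j $ l - z * N $ j $ l)) \<le> Es j + cmod z * Fs j" for j z
  proof -
    have "(\<Sum>l\<in>UNIV - {j}. cmod (M $ j $ l - z * N $ j $ l))
        \<le> (\<Sum>l\<in>UNIV - {j}. cmod (E $ j $ l) + cmod z * cmod (F $ j $ l))"
      by (rule sum_mono) (metis DiffE off insertI1 norm_mult norm_triangle_ineq4)
    also have "\<dots> \<le> (\<Sum>l\<in>UNIV. cmod (E $ j $ l) + cmod z * cmod (F $ j $ l))"
      by (rule sum_mono2) auto
    also have "\<dots> = Es j + cmod z * Fs j"
      by (simp add: Es Fs sum.distrib sum_distrib_left)
    finally show ?thesis .
  qed
  \<comment> \<open>Dominance needs \<open>Es j + cmod z * Fs j < cmod (z - lam $ j)\<close>.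
    Bounding \<open>cmod z\<close> by the triangle inequality and solving for the distance gives
    exactly the radius \<open>\<rho> j\<close>.\<close>
  have gershgorin: "(\<Sum>l\<in>UNIV - {j}. cmod (M $ j $ l - z * N $ j $ l)) < cmod (M $ j $ j - z * N $ j $ j)"
    if "\<rho> j < cmod (z - lam $ j)" for j z
  proof -
    have "\<rho> j * (1 - Fs j) < cmod (z - lam $ j) * (1 - Fs j)" using that F1[of j] by simp
    moreover have "cmod z * Fs j \<le> (cmod (lam $ j) + cmod (z - lam $ j)) * Fs j"
      using nonneg norm_triangle_sub[of z "lam $ j"] by (intro mult_right_mono) auto
    ultimately have "Es j + cmod z * Fs j < cmod (z - lam $ j)"
      using \<rho>_eq[of j] by (simp add: algebra_simps)
    then show ?thesis using offsum[of j z] by (simp add: on norm_minus_commute)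
  qed

  have "det N \<noteq> 0"
  proof (rule diag_dominant_det_nonzero)
    fix j
    have "(\<Sum>l\<in>UNIV - {j}. cmod (N $ j $ l)) = (\<Sum>l\<in>UNIV - {j}. cmod (F $ j $ l))"
      by (simp add: off)
    also have "\<dots> \<le> Fs j" unfolding Fs by (rule sum_mono2) auto
    finally show "(\<Sum>l\<in>UNIV - {j}. cmod (N $ j $ l)) < cmod (N $ j $ j)"
      using F1[of j] by (simp add: on)
  qed
  \<comment> \<open>\<open>det N\<close> is a product with the determinants of both matrices as
    factors.\<close>
  then have "invertible (conj_transpose Y)" "invertible X"
    by (auto simp: N_def det_mul invertible_det_nz)
  then have eigs: "finite_eigenvalues A B = finite_eigenvalues M N"
    by (simp add: M_def N_def finite_eigenvalues_equivalent)

  \<comment> \<open>Isolating circle and root count\<close>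
  have ne: "UNIV - {i} \<noteq> {}"
  proof
    assume "UNIV - {i} = {}"
    then have "(UNIV :: 'n set) = {i}" by blast
    then have "CARD('n) = 1" by (metis card.empty card_insert_disjoint empty_iff finite.emptyI One_nat_def)
    with assms(1) show False by simp
  qed
  have sep: "\<rho> i + \<rho> j < dist (lam $ i) (lam $ j)" if "j \<noteq> i" for j
  proof -
    have "D k = cball (lam $ k) (\<rho> k)" for k by (auto simp: D dist_norm norm_minus_commute)
    then show ?thesis using disj[OF that] \<rho>_nonneg cball_disjoint_iff by metis
  qed
  \<comment> \<open>\<open>G\<close> is the distance from \<open>lam $ i\<close> to the nearest
    other disk. The midpoint \<open>R\<close> leaves room on both sides: its circle avoids
    \<open>D i\<close>, its closed disk all other disks.\<close>
  define G where "G = Min ((\<lambda>j. dist (lam $ i) (lam $ j) - \<rho> j) ` (UNIV - {i}))"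
  have "\<rho> i < G" unfolding G_def using ne sep by (subst Min_gr_iff) (auto simp: algebra_simps)
  define R where "R = (\<rho> i + G) / 2"
  have R: "\<rho> i < R" "R < G" "0 < R" using \<open>\<rho> i < G\<close> \<rho>_nonneg[of i] by (auto simp: R_def)
  have outside: "\<rho> j < cmod (z - lam $ j)" if "z \<in> cball (lam $ i) R" "j \<noteq> i" for z j
  proof -
    have "G \<le> dist (lam $ i) (lam $ j) - \<rho> j" unfolding G_def using that by (intro Min_le) auto
    moreover have "dist (lam $ i) (lam $ j) \<le> dist (lam $ i) z + dist z (lam $ j)"
      by (rule dist_triangle)
    ultimately show ?thesis using that R by (simp add: dist_norm)
  qed
  have one: "size (filter_mset (\<lambda>z. z \<in> ball (lam $ i) R) (finite_eigenvalues M N)) = 1"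
    unfolding on(1)[symmetric]
  proof (rule pencil_root_count_isolated_row)
    fix z j assume "z \<in> cball (M $ i $ i) R" "j \<noteq> i"
    then show "(\<Sum>l\<in>UNIV - {j}. cmod (M $ j $ l - z * N $ j $ l)) < cmod (M $ j $ j - z * N $ j $ j)"
      by (intro gershgorin outside) (simp_all add: on)
  next
    fix z assume "z \<in> sphere (M $ i $ i) R"
    then show "(\<Sum>l\<in>UNIV - {i}. cmod (M $ i $ l - z * N $ i $ l)) < cmod (M $ i $ i - z * N $ i $ i)"
      using R by (intro gershgorin) (simp add: on dist_norm norm_minus_commute)
  qed (use R in \<open>simp_all add: on\<close>)
  have singular: "det (M - mat z ** N) = 0" if "z \<in># finite_eigenvalues M N" for z
    using that by (cases "pencil_poly M N = 0")
      (auto simp: finite_eigenvalues_def simp flip: pencil_poly_eval)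
  have entry: "(M - mat z ** N) $ j $ l = M $ j $ l - z * N $ j $ l" for z j l
    by (simp add: mat_mult_left_component)
  \<comment> \<open>The ring between \<open>D i\<close> and the circle contains no eigenvalue, since
    every row is strictly dominant there.\<close>
  have in_disc: "z \<in> D i \<longleftrightarrow> z \<in> ball (lam $ i) R" if "z \<in># finite_eigenvalues M N" for z
  proof
    assume "z \<in> ball (lam $ i) R"
    then have "z \<in> cball (lam $ i) R" by auto
    show "z \<in> D i"
    proof (rule ccontr)
      assume "z \<notin> D i"
      then have "\<rho> j < cmod (z - lam $ j)" for j
        using outside[OF \<open>z \<in> cball (lam $ i) R\<close>, of j] by (cases "j = i") (auto simp: D)
      then have "det (M - mat z ** N) \<noteq> 0"
        by (intro diag_dominant_det_nonzero) (simp only: entry gershgorin)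
      with singular[OF that] show False by simp
    qed
  qed (use R in \<open>auto simp: D dist_norm norm_minus_commute\<close>)
  have "filter_mset (\<lambda>z. z \<in> D i) (finite_eigenvalues M N) =
      filter_mset (\<lambda>z. z \<in> ball (lam $ i) R) (finite_eigenvalues M N)"
    using in_disc by (intro filter_mset_cong) auto
  then obtain \<mu> where \<mu>: "filter_mset (\<lambda>z. z \<in> D i) (finite_eigenvalues M N) = {#\<mu>#}"
    using size_1_singleton_mset[OF one] by auto
  then have "\<mu> \<in># filter_mset (\<lambda>z. z \<in> D i) (finite_eigenvalues M N)" by simp
  then have \<mu>_eig: "\<mu> \<in># finite_eigenvalues M N" and \<mu>D: "\<mu> \<in> D i" by auto
  have \<mu>R: "\<mu> \<in> cball (lam $ i) R" using \<mu>D R by (auto simp: D dist_norm norm_minus_commute)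

  \<comment> \<open>Eigenvector estimate\<close>
  obtain v where v: "v \<noteq> 0" "(M - mat \<mu> ** N) *v v = 0"
    using det_zero_imp_kernel singular[OF \<mu>_eig] by blast
  obtain k where k: "v $ k \<noteq> 0" "\<And>l. norm (v $ l) \<le> norm (v $ k)"
      "norm (M $ k $ k - \<mu> * N $ k $ k) \<le> (\<Sum>l\<in>UNIV - {k}. norm (M $ k $ l - \<mu> * N $ k $ l))"
    using kernel_max_row[OF v(2,1)] unfolding entry by blast
  \<comment> \<open>Row \<open>k\<close> is not strictly dominant, which puts \<mu> into
    \<open>D k\<close>.\<close>
  have "k = i" using gershgorin[of k \<mu>] outside[OF \<mu>R, of k] k(3) by force
  \<comment> \<open>The second largest modulus may be 0; only \<open>m\<close>, which is positive,
    serves as a divisor.\<close>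
  define T where "T = Max ((\<lambda>j. cmod (v $ j)) ` (UNIV - {i}))"
  have "T \<in> (\<lambda>j. cmod (v $ j)) ` (UNIV - {i})" unfolding T_def using ne by (intro Max_in) auto
  then obtain j where j: "j \<noteq> i" "T = cmod (v $ j)" by auto
  have T: "cmod (v $ l) \<le> T" if "l \<noteq> i" for l unfolding T_def using that by (intro Max_ge) auto
  define m where "m = cmod (v $ i)"
  have m: "0 < m" "\<And>l. cmod (v $ l) \<le> m" using k \<open>k = i\<close> by (auto simp: m_def)

  have row_i: "cmod (\<mu> - lam $ i) * m \<le> (Es i + cmod \<mu> * Fs i) * T"
  proof -
    have "cmod (\<mu> - lam $ i) * m \<le> (\<Sum>l\<in>UNIV - {i}. cmod (M $ i $ l - \<mu> * N $ i $ l)) * T"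
      using kernel_row_norm[OF v(2), of i T] T unfolding entry by (simp add: on norm_minus_commute m_def)
    also have "\<dots> \<le> (Es i + cmod \<mu> * Fs i) * T"
      using offsum[of i \<mu>] j(2) by (intro mult_right_mono) auto
    finally show ?thesis .
  qed
  have row_j: "cmod (\<mu> - lam $ j) * T \<le> (Es j + cmod \<mu> * Fs j) * m"
  proof -
    have "cmod (\<mu> - lam $ j) * T \<le> (\<Sum>l\<in>UNIV - {j}. cmod (M $ j $ l - \<mu> * N $ j $ l)) * m"
      using kernel_row_norm[OF v(2), of j m] m unfolding entry by (simp add: on norm_minus_commute j)
    also have "\<dots> \<le> (Es j + cmod \<mu> * Fs j) * m"
      using offsum[of j \<mu>] m by (intro mult_right_mono) auto
    finally show ?thesis .
  qed
  have r_ge: "(2 * cmod (lam $ l) + cmod (lam $ i)) * Fs l + Es l \<le> (1 - Fs i) * r" for l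
  proof -
    have "(1 - Fs i) * r = Max (range (\<lambda>j. (2 * cmod (lam $ j) + cmod (lam $ i)) * Fs j + Es j))"
      using F1[of i] by (simp add: r)
    then show ?thesis by simp
  qed
  have \<delta>_le: "\<delta> \<le> cmod (lam $ i - lam $ l)" if "l \<noteq> i" for l
    unfolding \<delta> using that by (intro Min_le) auto
  \<comment> \<open>Disjointness separates the centres by more than
    \<open>\<rho> i + \<rho> j\<close>, so the denominator \<open>\<delta>'\<close> is
    positive.\<close>
  have "\<rho> i < \<delta>"
    unfolding \<delta> using ne sep \<rho>_nonneg by (subst Min_gr_iff) (auto simp: dist_norm, smt (verit))
  have "cmod (\<mu> - lam $ i) \<le> r\<^sup>2 / (\<delta> - \<rho> i)"
  proof (rule eigenvalue_error_bound_arith[where a = "T / m" and u = "cmod \<mu>" and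
        w = "cmod (\<mu> - lam $ j)" and x = "cmod (lam $ i - lam $ j)"])
    show "0 \<le> T / m" "T / m \<le> 1" using m j(2) by auto
    show "cmod (\<mu> - lam $ i) \<le> (Es i + cmod \<mu> * Fs i) * (T / m)"
      using row_i m(1) by (simp add: field_simps)
    show "cmod (\<mu> - lam $ j) * (T / m) \<le> Es j + cmod \<mu> * Fs j"
      using row_j m(1) by (simp add: field_simps)
    show "cmod \<mu> \<le> cmod (lam $ i) + cmod (\<mu> - lam $ i)" "cmod \<mu> \<le> cmod (lam $ j) + cmod (\<mu> - lam $ j)"
      by (rule norm_triangle_sub)+
    show "cmod (lam $ i - lam $ j) \<le> cmod (\<mu> - lam $ j) + cmod (\<mu> - lam $ i)"
      using norm_triangle_ineq4[of "\<mu> - lam $ j" "\<mu> - lam $ i"] by simp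
    show "cmod (lam $ i - lam $ j) \<le> cmod (lam $ i) + cmod (lam $ j)"
      by (rule norm_triangle_ineq4)
    show "(2 * cmod (lam $ i) + cmod (lam $ i)) * Fs i + Es i \<le> (1 - Fs i) * r" by (rule r_ge)
    show "cmod (\<mu> - lam $ i) \<le> \<rho> i" using \<mu>D by (simp add: D)
  qed (use nonneg F1 \<rho> r_ge \<delta>_le j \<open>\<rho> i < \<delta>\<close> in auto)
  with \<mu> show ?thesis by (auto simp: eigs \<delta>')
qed

end
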